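(* Let $n,k$ be positive integers with $2\leq 2k<n$ and $\gcd(n,k)=1$. Then the maximum frustration of the generalised Petersen graph $P_{n,k}$ satisfies $D(P_{n,k})\leq \lfloor n/2\rfloor+1$.
   Context: For positive integers $n,k$ with $2\le 2k<n$, the generalised Petersen graph $P_{n,k}$ has vertex set $\{u_i,v_i: i\in\{0,\dots,n-1\}\}$ and edge set $\{u_iu_{i+1}, v_iv_{i+k}, u_iv_i : i\in\{0,\dots,n-1\}\}$, indices modulo $n$. A signed graph $(G,E_-)$ is a simple graph $G$ with a set $E_-\subseteq E(G)$ of negative edges (the signature); other edges are positive. A cycle is positive if the product of its edge signs is positive; a signed graph is balanced if every cycle is positive. The frustration index $l(G,E_-)$ is the minimum number of edges whose deletion leaves a balanced signed graph. The maximum frustration of $G$ is $D(G)=\max_{E_-\subseteq E(G)} l(G,E_-)$. *)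

theory Defs
  imports Main
begin

text \<open>Finite simple graphs, with edges represented as two-element sets of vertices.\<close>

record 'a graph =
  verts :: "'a set"
  edges :: "'a set set"

definition simple_graph :: "'a graph \<Rightarrow> bool" where
  "simple_graph G \<longleftrightarrow> finite (verts G) \<and> (\<forall>e\<in>edges G. e \<subseteq> verts G \<and> card e = 2)"

definition delete_edges :: "'a graph \<Rightarrow> 'a set set \<Rightarrow> 'a graph" where
  "delete_edges G F = G\<lparr>edges := edges G - F\<rparr>"

text \<open>
  A cycle is given by its cyclic sequence of vertices. As there are at least three of them and
  they are distinct, the edges listed in \<open>cycle_edges\<close> are pairwise distinct, so that each
  contributes exactly once to the product in \<open>positive_cycle\<close>.
\<close>

definition cycle_edges :: "'a list \<Rightarrow> 'a set set" where
  "cycle_edges c = {{c ! i, c ! (Suc i mod length c)} | i. i < length c}"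

definition is_cycle :: "'a graph \<Rightarrow> 'a list \<Rightarrow> bool" where
  "is_cycle G c \<longleftrightarrow>
     3 \<le> length c \<and> distinct c \<and> set c \<subseteq> verts G \<and> cycle_edges c \<subseteq> edges G"

text \<open>A signed graph is a graph \<open>G\<close> together with its set \<open>N \<subseteq> edges G\<close> of negative edges.\<close>

definition edge_sign :: "'a set set \<Rightarrow> 'a set \<Rightarrow> int" where
  "edge_sign N e = (if e \<in> N then - 1 else 1)"

definition positive_cycle :: "'a set set \<Rightarrow> 'a list \<Rightarrow> bool" where
  "positive_cycle N c \<longleftrightarrow> 0 < (\<Prod>e\<in>cycle_edges c. edge_sign N e)"

definition balanced :: "'a graph \<Rightarrow> 'a set set \<Rightarrow> bool" where
  "balanced G N \<longleftrightarrow> (\<forall>c. is_cycle G c \<longrightarrow> positive_cycle N c)"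

definition balancing_deletions :: "'a graph \<Rightarrow> 'a set set \<Rightarrow> 'a set set set" where
  "balancing_deletions G N = {F. F \<subseteq> edges G \<and> balanced (delete_edges G F) (N - F)}"

definition frustration_index :: "'a graph \<Rightarrow> 'a set set \<Rightarrow> nat" where
  "frustration_index G N = Min (card ` balancing_deletions G N)"

definition max_frustration :: "'a graph \<Rightarrow> nat" where
  "max_frustration G = Max (frustration_index G ` Pow (edges G))"

text \<open>The minimum and the maximum range over finite nonempty sets.\<close>

lemma finite_edges: "finite (edges G)" if "simple_graph G"
proof -
  have "edges G \<subseteq> Pow (verts G)"
    using that by (auto simp: simple_graph_def)
  then show ?thesis
    using that finite_subset by (auto simp: simple_graph_def)
qed

lemma finite_balancing_deletions: "finite (balancing_deletions G N)" if "simple_graph G"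
  using finite_edges[OF that] by (simp add: balancing_deletions_def)

lemma edges_in_balancing_deletions: "edges G \<in> balancing_deletions G N"
proof -
  have "\<not> is_cycle (delete_edges G (edges G)) c" for c
    by (cases c) (auto simp: is_cycle_def delete_edges_def cycle_edges_def)
  then show ?thesis
    by (simp add: balancing_deletions_def balanced_def)
qed

text \<open>
  The generalised Petersen graph \<open>P\<^bsub>n,k\<^esub>\<close>, for \<open>2 \<le> 2 * k < n\<close>; \<open>U i\<close> and \<open>V i\<close> stand for
  \<open>u\<^sub>i\<close> and \<open>v\<^sub>i\<close>.
\<close>

datatype petersen_vertex = U nat | V nat

definition gen_petersen :: "nat \<Rightarrow> nat \<Rightarrow> petersen_vertex graph" where
  "gen_petersen n k = \<lparr>
     verts = U ` {..<n} \<union> V ` {..<n},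
     edges = {{U i, U ((i + 1) mod n)} | i. i < n}
           \<union> {{V i, V ((i + k) mod n)} | i. i < n}
           \<union> {{U i, V i} | i. i < n}\<rparr>"

lemma simple_graph_gen_petersen:
  assumes "2 \<le> 2 * k" "2 * k < n"
  shows "simple_graph (gen_petersen n k)"
proof -
  have "i \<noteq> (i + d) mod n" if "i < n" "0 < d" "d < n" for i d
    using that by (cases "i + d < n") (auto simp: mod_if)
  from this[of _ 1] this[of _ k] show ?thesis
    using assms by (auto simp: simple_graph_def gen_petersen_def card_insert_if)
qed

end

theory Submission
  imports Defs "HOL-Number_Theory.Cong"
begin

text \<open>
  Deleting the edges that are negative after some switching leaves a balanced graph, so it suffices
  to find a switching with few negative edges. Since \<open>gcd n k = 1\<close>, the outer and the inner rim are
  both \<open>n\<close>-cycles, and each can be switched to have at most one negative edge, at a place of our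
  choice: \<open>u\<^bsub>n-1\<^esub>u\<^sub>0\<close> and \<open>v\<^bsub>n-k\<^esub>v\<^sub>0\<close>.
  Switching the whole inner rim exchanges positive and negative spokes,
  so at most \<open>\<lfloor>n/2\<rfloor>\<close> of them need be negative. This suffices unless both rims have a
  negative edge. In that case, switching \<open>u\<^sub>0\<close> or \<open>v\<^bsub>n-k\<^esub>\<close> merely moves the negative edge
  along its rim and toggles one spoke, and the two toggled spokes are distinct. Using none, one or
  both of these moves, the number of negative spokes can be brought to at most \<open>\<lfloor>n/2\<rfloor> - 1\<close>
  or at least \<open>\<lceil>n/2\<rceil> + 1\<close>.
\<close>

section \<open>Switching\<close>

text \<open>\<open>f\<close> marks the switched vertices; the separated edges form the cut whose
  signs the switching flips.\<close>

definition separates :: "('a \<Rightarrow> bool) \<Rightarrow> 'a set \<Rightarrow> bool" where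
  "separates f e \<longleftrightarrow> (\<exists>a\<in>e. \<exists>b\<in>e. f a \<noteq> f b)"

lemma separates_insert2 [simp]: "separates f {a, b} \<longleftrightarrow> f a \<noteq> f b"
  by (auto simp: separates_def)

lemma cycle_edge_index_inj:
  assumes "3 \<le> length c" "distinct c"
  shows "inj_on (\<lambda>i. {c ! i, c ! (Suc i mod length c)}) {..<length c}"
proof (rule inj_onI)
  fix i j
  let ?l = "length c"
  assume i: "i \<in> {..<?l}" and j: "j \<in> {..<?l}"
    and eq: "{c ! i, c ! (Suc i mod ?l)} = {c ! j, c ! (Suc j mod ?l)}"
  have less: "i < ?l" "j < ?l" "Suc i mod ?l < ?l" "Suc j mod ?l < ?l"
    using i j by (auto intro!: mod_less_divisor)
  \<comment> \<open>The crossed alternative would make \<open>i\<close> congruent to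
    \<open>i + 2\<close> modulo the length, which is excluded because the length is at least
    3.\<close>
  from eq have "i = j \<or> (i = Suc j mod ?l \<and> j = Suc i mod ?l)"
    using less assms(2) by (auto simp: doubleton_eq_iff nth_eq_iff_index_eq)
  then show "i = j"
    using less assms(1) by (auto simp: mod_Suc split: if_splits)
qed

lemma prod_rotate_index:
  fixes g :: "nat \<Rightarrow> 'a::comm_monoid_mult"
  shows "(\<Prod>i<m. g (Suc i mod m)) = (\<Prod>i<m. g i)"
proof (cases m)
  case (Suc l)
  have "(\<Prod>i<Suc l. g (Suc i mod Suc l)) = (\<Prod>i<l. g (Suc i)) * g 0"
    by simp
  also have "\<dots> = (\<Prod>i<Suc l. g i)"
    by (subst prod.lessThan_Suc_shift) (simp add: mult.commute)
  finally show ?thesis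
    using Suc by simp
qed simp

text \<open>Each edge sign is the product of the signs \<open>s\<close> of its two ends. Around a
  cycle every vertex occurs in two edges, so the product is a nonzero square.\<close>

lemma balanced_if_separates:
  assumes "\<And>e. e \<in> edges G \<Longrightarrow> e \<in> N \<longleftrightarrow> separates f e"
  shows "balanced G N"
  unfolding balanced_def
proof (intro allI impI)
  fix c
  assume c: "is_cycle G c"
  let ?l = "length c"
  let ?e = "\<lambda>i. {c ! i, c ! (Suc i mod ?l)}"
  define s :: "_ \<Rightarrow> int" where "s v = (if f v then - 1 else 1)" for v
  have edges: "cycle_edges c = ?e ` {..<?l}"
    by (auto simp: cycle_edges_def)
  have sign: "edge_sign N (?e i) = s (c ! i) * s (c ! (Suc i mod ?l))" if "i < ?l" for i
  proof -
    have "?e i \<in> edges G"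
      using c that by (auto simp: is_cycle_def edges)
    from assms[OF this] show ?thesis
      by (simp add: edge_sign_def s_def)
  qed
  have "(\<Prod>e\<in>cycle_edges c. edge_sign N e) = (\<Prod>i<?l. edge_sign N (?e i))"
    using cycle_edge_index_inj[of c] c
    by (simp add: edges prod.reindex is_cycle_def)
  also have "\<dots> = (\<Prod>i<?l. s (c ! i)) * (\<Prod>i<?l. s (c ! (Suc i mod ?l)))"
    by (simp add: sign prod.distrib)
  also have "\<dots> = (\<Prod>i<?l. s (c ! i))\<^sup>2"
    using prod_rotate_index[of "\<lambda>i. s (c ! i)" ?l] by (simp add: power2_eq_square)
  also have "\<dots> > 0"
    by (simp add: s_def)
  finally show "positive_cycle N c"
    by (simp add: positive_cycle_def)
qed

text \<open>Once the edges that disagree with the cut of \<open>f\<close> are deleted, the remaining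
  signature is exactly that cut.\<close>

lemma frustration_index_le_switching:
  assumes "simple_graph G"
  shows "frustration_index G N \<le> card {e \<in> edges G. (e \<in> N) \<noteq> separates f e}"
proof -
  let ?F = "{e \<in> edges G. (e \<in> N) \<noteq> separates f e}"
  have "balanced (delete_edges G ?F) (N - ?F)"
    by (rule balanced_if_separates[of _ _ f]) (auto simp: delete_edges_def)
  then have "?F \<in> balancing_deletions G N"
    by (simp add: balancing_deletions_def)
  then show ?thesis
    unfolding frustration_index_def
    by (intro Min_le finite_imageI finite_balancing_deletions assms imageI)
qed

section \<open>Rims\<close>

text \<open>
  The negative edges, after switching by \<open>x\<close>, of the circulant graph on \<open>{..<n}\<close> with edges
  \<open>i, i + d\<close>; here \<open>A i\<close> states that the edge \<open>i, i + d\<close> was originally negative.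
\<close>

definition negatives :: "nat \<Rightarrow> nat \<Rightarrow> (nat \<Rightarrow> bool) \<Rightarrow> (nat \<Rightarrow> bool) \<Rightarrow> nat set" where
  "negatives n d A x = {i. i < n \<and> A i \<noteq> (x i \<noteq> x ((i + d) mod n))}"

lemma negatives_complement [simp]: "negatives n d A (\<lambda>i. x i \<noteq> R) = negatives n d A x"
  by (auto simp: negatives_def)

text \<open>As \<open>d\<close> is invertible modulo \<open>n\<close>, the walk
  \<open>0, d, 2 * d, ...\<close> visits every index once. Choosing \<open>x\<close> along it makes
  each edge positive except possibly the closing one, from \<open>n - d\<close> back to
  \<open>0\<close>.\<close>

lemma ex_negatives_subset:
  assumes "coprime d n" "0 < d" "d < n"
  shows "\<exists>x. negatives n d A x \<subseteq> {n - d}"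
proof -
  obtain e where e: "[d * e = 1] (mod n)"
    using assms(1) cong_solve_coprime_nat by auto
  \<comment> \<open>\<open>g j\<close> is the value at the \<open>j\<close>-th vertex of the walk,
    and \<open>e * i mod n\<close> is the position of \<open>i\<close> on it.\<close>
  define g where "g = rec_nat False (\<lambda>j b. b \<noteq> A (j * d mod n))"
  define x where "x i = g (e * i mod n)" for i
  have g_Suc: "g (Suc j) \<longleftrightarrow> g j \<noteq> A (j * d mod n)" for j
    by (simp add: g_def)
  have "A i = (x i \<noteq> x ((i + d) mod n))" if i: "i < n" "i \<noteq> n - d" for i
  proof -
    define j where "j = e * i mod n"
    have j: "j < n"
      using assms by (simp add: j_def)
    have "[j * d = d * e * i] (mod n)"
      by (simp add: j_def cong_def mod_mult_right_eq ac_simps)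
    also have "[d * e * i = 1 * i] (mod n)"
      using e by (rule cong_scalar_right)
    finally have ji: "[j * d = i] (mod n)"
      by simp
    have "[e * ((i + d) mod n) = e * i + d * e] (mod n)"
      by (simp add: cong_def mod_mult_right_eq algebra_simps)
    also have "[e * i + d * e = j + 1] (mod n)"
      using e by (intro cong_add) (simp_all add: j_def cong_def)
    finally have next_j: "e * ((i + d) mod n) mod n = Suc j mod n"
      by (simp add: cong_def)
    have "Suc j \<noteq> n"
    proof
      assume n: "Suc j = n"
      have "[i + d = j * d + d] (mod n)"
        using ji by (simp add: cong_add_rcancel_nat cong_sym)
      also have "j * d + d = n * d"
        using n by (metis add.commute mult_Suc)
      finally have "(i + d) mod n = 0"
        by (simp add: cong_def)
      then show False
        using i assms by (auto simp: mod_if[of "i + d"] mod_if[of "i + d - n"] split: if_splits)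
    qed
    then have "x ((i + d) mod n) = g (Suc j)"
      using j by (simp add: x_def next_j)
    moreover have "x i = g j"
      by (simp add: x_def j_def)
    moreover have "j * d mod n = i"
      using ji i by (simp add: cong_def)
    ultimately show ?thesis
      by (auto simp: g_Suc)
  qed
  then have "negatives n d A x \<subseteq> {n - d}"
    unfolding negatives_def by blast
  then show ?thesis
    by blast
qed

text \<open>Switching one end of a unique negative edge moves that edge across this end.\<close>

lemma card_negatives_switch_le_1:
  assumes "negatives n d A x = {a}" "0 < d" "2 * d < n" "p = a \<or> p = (a + d) mod n"
  shows "card (negatives n d A (\<lambda>i. x i \<noteq> (P \<and> i = p))) \<le> 1"
proof (cases P)
  case True
  have shift_inj: "i = j" if "(i + d) mod n = (j + d) mod n" "i < n" "j < n" for i j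
  proof -
    have "[i + d = j + d] (mod n)"
      using that by (simp add: cong_def)
    then have "[i = j] (mod n)"
      by (simp add: cong_add_rcancel_nat)
    then show ?thesis
      using that by (simp add: cong_def)
  qed
  have no_loop: "(i + d) mod n \<noteq> i" if "i < n" for i
    using that assms by (cases "i + d < n") (auto simp: mod_if)
  have a: "a < n"
    using assms(1) by (auto simp: negatives_def)
  then have p: "p < n"
    using assms(4) by auto
  have mem: "i < n \<Longrightarrow> A i \<noteq> (x i \<noteq> x ((i + d) mod n)) \<longleftrightarrow> i = a" for i
    using assms(1) by (auto simp: negatives_def)
  have "i = j"
    if "i \<in> negatives n d A (\<lambda>i. x i \<noteq> (P \<and> i = p))"
      "j \<in> negatives n d A (\<lambda>i. x i \<noteq> (P \<and> i = p))" for i j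
  proof -
    \<comment> \<open>Switching \<open>p\<close> toggles just the two rim edges at \<open>p\<close>.
      One of them is \<open>a\<close>, which becomes positive, so only the other can be
      negative.\<close>
    have *: "l < n \<and> (l \<noteq> a) = ((l = p) \<noteq> ((l + d) mod n = p))"
      if "l \<in> negatives n d A (\<lambda>i. x i \<noteq> (P \<and> i = p))" for l
      using that mem[of l] True by (auto simp: negatives_def)
    show ?thesis
      using *[OF that(1)] *[OF that(2)] assms(4) shift_inj[of i j] shift_inj[of i a]
        shift_inj[of j a] no_loop[OF a] no_loop[of i] no_loop[of j] a p by metis
  qed
  moreover have "finite (negatives n d A (\<lambda>i. x i \<noteq> (P \<and> i = p)))"
    by (simp add: negatives_def)
  ultimately show ?thesis
    unfolding One_nat_def by (subst card_le_Suc0_iff_eq) blast+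
qed (use assms(1) in simp)

section \<open>Spokes\<close>

lemma card_toggle:
  fixes T :: "nat \<Rightarrow> bool"
  assumes "p < n"
  shows "card {i. i < n \<and> T i \<noteq> (i = p)} =
    (if T p then card {i. i < n \<and> T i} - 1 else card {i. i < n \<and> T i} + 1)"
proof (cases "T p")
  case True
  then have "{i. i < n \<and> T i \<noteq> (i = p)} = {i. i < n \<and> T i} - {p}"
    by auto
  then show ?thesis
    using True assms by (simp add: card_Diff_singleton)
next
  case False
  then have "{i. i < n \<and> T i \<noteq> (i = p)} = insert p {i. i < n \<and> T i}"
    using assms by auto
  then show ?thesis
    using False by simp
qed

lemma card_complement:
  "card {i. i < n \<and> \<not> T i} = n - card {i. i < (n::nat) \<and> T i}"
proof -
  have "{i. i < n \<and> \<not> T i} = {..<n} - {i. i < n \<and> T i}"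
    by auto
  then show ?thesis
    by (simp add: card_Diff_subset subset_iff)
qed

lemma ex_complement_card_le:
  fixes T :: "nat \<Rightarrow> bool"
  shows "\<exists>R. card {i. i < n \<and> T i \<noteq> R} \<le> n div 2"
proof (cases "card {i. i < n \<and> T i} \<le> n div 2")
  case True
  then show ?thesis
    by (intro exI[of _ False]) simp
next
  case False
  then show ?thesis
    by (intro exI[of _ True]) (simp add: card_complement)
qed

text \<open>Among the four counts given by \<open>P\<close> and \<open>Q\<close>, two differ by 2:
  those for none and both if the toggles act in the same direction, otherwise those for the single
  toggles. They cannot all lie between \<open>n div 2\<close> and \<open>n - n div 2\<close>; a
  count that is too large is complemented by \<open>R\<close>.\<close>

lemma ex_toggles_card_less:
  fixes T :: "nat \<Rightarrow> bool"
  assumes "p < n" "q < n" "p \<noteq> q"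
  shows "\<exists>P Q R. card {i. i < n \<and> ((T i \<noteq> (P \<and> i = p)) \<noteq> (Q \<and> i = q)) \<noteq> R} < n div 2"
proof -
  define c where "c = (\<lambda>P Q. card {i. i < n \<and> ((T i \<noteq> (P \<and> i = p)) \<noteq> (Q \<and> i = q))})"
  define N where "N = c False False"
  define h where "h = n div 2"
  have h: "n = 2 * h \<or> n = 2 * h + 1"
    unfolding h_def by linarith
  have pos: "0 < card {i. i < n \<and> T' i}" if "T' i" "i < n" for T' :: "nat \<Rightarrow> bool" and i
    using that by (auto simp: card_gt_0_iff)
  have p: "if T p then c True False + 1 = N else c True False = N + 1"
    using card_toggle[OF assms(1), of T] pos[of T p] assms(1) by (auto simp: c_def N_def)
  have q: "if T q then c False True + 1 = N else c False True = N + 1"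
    using card_toggle[OF assms(2), of T] pos[of T q] assms(2) by (auto simp: c_def N_def)
  have pq: "if T q then c True True + 1 = c True False else c True True = c True False + 1"
    using card_toggle[OF assms(2), of "\<lambda>i. T i \<noteq> (i = p)"]
      pos[of "\<lambda>i. T i \<noteq> (i = p)" q] assms(2,3) by (auto simp: c_def)
  have "\<exists>P Q. c P Q < h \<or> n < c P Q + h"
  proof (rule ccontr)
    assume "\<not> ?thesis"
    then have "h \<le> c P Q \<and> c P Q + h \<le> n" for P Q
      by (simp add: not_less)
    from this[of False False] this[of True False] this[of False True] this[of True True]
    show False
      using p q pq h by (cases "T p"; cases "T q"; simp add: N_def; linarith)
  qed
  then obtain P Q where "c P Q < h \<or> n < c P Q + h"
    by blast
  then show ?thesis
  proof
    assume "c P Q < h"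
    then show ?thesis
      by (intro exI[of _ P] exI[of _ Q] exI[of _ False]) (simp add: c_def h_def)
  next
    assume "n < c P Q + h"
    \<comment> \<open>This makes \<open>h\<close> positive, as needed if the subtraction
      \<open>n - c P Q\<close> yields 0.\<close>
    moreover have "1 < n"
      using assms by linarith
    ultimately have "n - c P Q < n div 2"
      using h unfolding h_def by linarith
    then have "card {i. i < n \<and> \<not> ((T i \<noteq> (P \<and> i = p)) \<noteq> (Q \<and> i = q))} < n div 2"
      unfolding card_complement c_def .
    then show ?thesis
      by (intro exI[of _ P] exI[of _ Q] exI[of _ True]) simp
  qed
qed

section \<open>Generalised Petersen graphs\<close>

text \<open>The outer rim is switched by \<open>x\<close> and the inner one by \<open>y\<close>; the
  edges then negative are covered by three indexed families.\<close>

lemma frustration_index_gen_petersen_le: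
  fixes n k N
  defines "A \<equiv> \<lambda>i. {U i, U ((i + 1) mod n)} \<in> N"
    and "B \<equiv> \<lambda>i. {V i, V ((i + k) mod n)} \<in> N"
    and "S \<equiv> \<lambda>i. {U i, V i} \<in> N"
  assumes "2 \<le> 2 * k" "2 * k < n"
  shows "frustration_index (gen_petersen n k) N \<le>
    card (negatives n 1 A x) + card (negatives n k B y) + card {i. i < n \<and> S i \<noteq> (x i \<noteq> y i)}"
proof -
  define f where "f v = (case v of U i \<Rightarrow> x i | V i \<Rightarrow> y i)" for v
  let ?u = "\<lambda>i. {U i, U ((i + 1) mod n)}" and ?v = "\<lambda>i. {V i, V ((i + k) mod n)}"
    and ?s = "\<lambda>i. {U i, V i}"
  let ?O = "negatives n 1 A x" and ?I = "negatives n k B y"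
    and ?S = "{i. i < n \<and> S i \<noteq> (x i \<noteq> y i)}"
  have fin: "finite ?O" "finite ?I" "finite ?S"
    by (auto simp: negatives_def)
  have "{e \<in> edges (gen_petersen n k). (e \<in> N) \<noteq> separates f e} \<subseteq>
      ?u ` ?O \<union> ?v ` ?I \<union> ?s ` ?S" (is "?F \<subseteq> _")
  proof
    fix e
    assume "e \<in> ?F"
    then obtain i where i: "i < n" "e = ?u i \<or> e = ?v i \<or> e = ?s i"
      and e: "(e \<in> N) \<noteq> separates f e"
      by (auto simp: gen_petersen_def)
    from i(2) show "e \<in> ?u ` ?O \<union> ?v ` ?I \<union> ?s ` ?S"
    proof (elim disjE)
      assume eq: "e = ?u i"
      with e i have "i \<in> ?O"
        by (simp add: negatives_def A_def f_def)
      with eq show ?thesis by blast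
    next
      assume eq: "e = ?v i"
      with e i have "i \<in> ?I"
        by (simp add: negatives_def B_def f_def)
      with eq show ?thesis by blast
    next
      assume eq: "e = ?s i"
      with e i have "i \<in> ?S"
        by (simp add: S_def f_def)
      with eq show ?thesis by blast
    qed
  qed
  then have "card ?F \<le> card (?u ` ?O \<union> ?v ` ?I \<union> ?s ` ?S)"
    using fin by (intro card_mono) auto
  also have "\<dots> \<le> card (?u ` ?O) + card (?v ` ?I) + card (?s ` ?S)"
    by (meson card_Un_le le_trans add_le_mono le_refl)
  also have "\<dots> \<le> card ?O + card ?I + card ?S"
    using fin by (intro add_mono card_image_le)
  finally show ?thesis
    using frustration_index_le_switching[OF simple_graph_gen_petersen, of k n N f] assms(4,5)
    by linarith
qed

theorem theorem3p3:
  fixes n k :: nat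
  assumes "0 < n" and "0 < k"
    and "2 \<le> 2 * k" and "2 * k < n"
    and "gcd n k = 1"
  shows "max_frustration (gen_petersen n k) \<le> n div 2 + 1"
proof -
  have "frustration_index (gen_petersen n k) N \<le> n div 2 + 1" for N
  proof -
    define A where "A i \<longleftrightarrow> {U i, U ((i + 1) mod n)} \<in> N" for i
    define B where "B i \<longleftrightarrow> {V i, V ((i + k) mod n)} \<in> N" for i
    define S where "S i \<longleftrightarrow> {U i, V i} \<in> N" for i
    have bound: "frustration_index (gen_petersen n k) N \<le> card (negatives n 1 A x)
        + card (negatives n k B y) + card {i. i < n \<and> S i \<noteq> (x i \<noteq> y i)}" for x y
      using frustration_index_gen_petersen_le[of k n N x y] assms
      unfolding A_def B_def S_def by simp
    have "coprime k n"
      using assms(5) by (simp add: coprime_iff_gcd_eq_1 gcd.commute)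
    with assms obtain y where y: "negatives n k B y \<subseteq> {n - k}"
      using ex_negatives_subset[of k n B] by auto
    obtain x where x: "negatives n 1 A x \<subseteq> {n - 1}"
      using ex_negatives_subset[of 1 n A] assms by auto
    show ?thesis
    proof (cases "negatives n 1 A x = {n - 1} \<and> negatives n k B y = {n - k}")
      case True
      \<comment> \<open>The toggled spokes must differ: the outer negative edge ends at
        \<open>U 0\<close>, so the end \<open>V (n - k)\<close> of the inner one is used and not
        \<open>V 0\<close>.\<close>
      obtain P Q R where "card {i. i < n \<and>
          (((S i \<noteq> (x i \<noteq> y i)) \<noteq> (P \<and> i = 0)) \<noteq> (Q \<and> i = n - k)) \<noteq> R} < n div 2"
        using ex_toggles_card_less[of 0 n "n - k" "\<lambda>i. S i \<noteq> (x i \<noteq> y i)"] assms by auto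
      moreover define x' where "x' = (\<lambda>i. x i \<noteq> (P \<and> i = 0))"
      moreover define y' where "y' = (\<lambda>i. y i \<noteq> (Q \<and> i = n - k))"
      moreover have "{i. i < n \<and> S i \<noteq> (x' i \<noteq> (y' i \<noteq> R))} = {i. i < n \<and>
          (((S i \<noteq> (x i \<noteq> y i)) \<noteq> (P \<and> i = 0)) \<noteq> (Q \<and> i = n - k)) \<noteq> R}"
        unfolding x'_def y'_def by auto
      ultimately have "card {i. i < n \<and> S i \<noteq> (x' i \<noteq> (y' i \<noteq> R))} < n div 2"
        by simp
      moreover have "card (negatives n 1 A x') \<le> 1"
        unfolding x'_def using True assms by (intro card_negatives_switch_le_1) auto
      moreover have "card (negatives n k B y') \<le> 1"
        unfolding y'_def using True assms by (intro card_negatives_switch_le_1) auto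
      ultimately show ?thesis
        using bound[of x' "\<lambda>i. y' i \<noteq> R"] unfolding negatives_complement by linarith
    next
      case False
      then have "negatives n 1 A x = {} \<or> negatives n k B y = {}"
        using x y by blast
      moreover have "card (negatives n 1 A x) \<le> 1" "card (negatives n k B y) \<le> 1"
        using card_mono[OF _ x] card_mono[OF _ y] by auto
      ultimately have "card (negatives n 1 A x) + card (negatives n k B y) \<le> 1"
        by auto
      \<comment> \<open>\<open>R\<close> switches the whole inner rim, which leaves both rims
        unchanged and flips every spoke.\<close>
      moreover obtain R where "card {i. i < n \<and> (S i \<noteq> (x i \<noteq> y i)) \<noteq> R} \<le> n div 2"
        using ex_complement_card_le[of n "\<lambda>i. S i \<noteq> (x i \<noteq> y i)"] by blast
      moreover have "{i. i < n \<and> S i \<noteq> (x i \<noteq> (y i \<noteq> R))} =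
          {i. i < n \<and> (S i \<noteq> (x i \<noteq> y i)) \<noteq> R}"
        by blast
      ultimately show ?thesis
        using bound[of x "\<lambda>i. y i \<noteq> R"] unfolding negatives_complement by simp
    qed
  qed
  moreover have "finite (edges (gen_petersen n k))"
    using assms by (intro finite_edges simple_graph_gen_petersen)
  ultimately show ?thesis
    unfolding max_frustration_def by (subst Max_le_iff) auto
qed

end
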